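(* Let $G$ be a discrete group with $n$ generators $\{\xi_1,\dots,\xi_n\}$ and set of relations $R$, and let $X$ be an object of some category $\mathscr{C}$. There is a bijective correspondence between multivariable nonautonomous difference equations of $G$ on $X$ and cotranslations $Z:G\times G\to\mathbb{A}_X$, which is given by $$A_i(\eta)=Z(\eta,\xi_i),\qquad \eta\in G,\ i=1,\dots,n.$$
   Context: $\mathbb{A}_X$ is the group of invertible morphisms (automorphisms) of $X$ in $\mathscr{C}$. The group $G$ is given by the presentation with generators $\xi_1,\dots,\xi_n$ and relations $R$. Each relation is a word $p\in R$ with a positive integer length $|p|$ and a map $j_p:\{1,\dots,|p|\}\to\{1,\dots,n\}$ such that $p=\xi_{j_p(|p|)}\,\xi_{j_p(|p|-1)}\cdots\xi_{j_p(2)}\,\xi_{j_p(1)}$ (the relation being that this word equals the unit of $G$). A collection of maps $A_i:G\to\mathbb{A}_X$, $i=1,\dots,n$, preserves relations if for each $p\in R$ and $\eta\in G$, $$\mathrm{Id}_X=A_{j_p(|p|)}\big(\xi_{j_p(|p|-1)}\cdots\xi_{j_p(1)}\eta\big)\circ\cdots\circ A_{j_p(2)}\big(\xi_{j_p(1)}\eta\big)\circ A_{j_p(1)}(\eta).$$ A multivariable nonautonomous difference equation of $G$ on $X$ is an equation of the form $x(\xi_i\eta)=A_i(\eta)x(\eta)$ ($i=1,\dots,n$, $\eta\in G$), where the collection of maps $A_i:G\to\mathbb{A}_X$, $i=1,\dots,n$, preserves relations; it is identified with the collection $(A_1,\dots,A_n)$. A cotranslation is a map $Z:G\times G\to\mathbb{A}_X$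 with $Z(g,kh)=Z(hg,k)\circ Z(g,h)$ for all $g,h,k\in G$ (equivalently, a groupoid morphism from the left translations groupoid $G\times G$ to the group $\mathbb{A}_X$). *)

theory Defs
  imports "HOL-Algebra.Generated_Groups"
begin

section \<open>Categories and automorphism groups\<close>

record ('o, 'm) category_data =
  Obj :: "'o set"
  Mor :: "'m set"
  Src :: "'m \<Rightarrow> 'o"
  Tgt :: "'m \<Rightarrow> 'o"
  Idt :: "'o \<Rightarrow> 'm"
  Comp :: "'m \<Rightarrow> 'm \<Rightarrow> 'm"

definition Hom :: "('o, 'm) category_data \<Rightarrow> 'o \<Rightarrow> 'o \<Rightarrow> 'm set" where
  "Hom C X Y = {f \<in> Mor C. Src C f = X \<and> Tgt C f = Y}"

text \<open>The composite \<open>Comp C g f\<close> means ``first \<open>f\<close>, then \<open>g\<close>''; it is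
  unconstrained when \<open>Tgt C f \<noteq> Src C g\<close>.\<close>

locale category =
  fixes C :: "('o, 'm) category_data"
  assumes src_in: "f \<in> Mor C \<Longrightarrow> Src C f \<in> Obj C"
    and tgt_in: "f \<in> Mor C \<Longrightarrow> Tgt C f \<in> Obj C"
    and idt_in: "X \<in> Obj C \<Longrightarrow> Idt C X \<in> Hom C X X"
    and comp_in: "f \<in> Hom C X Y \<Longrightarrow> g \<in> Hom C Y Z \<Longrightarrow> Comp C g f \<in> Hom C X Z"
    and comp_idt: "f \<in> Hom C X Y \<Longrightarrow> Comp C f (Idt C X) = f"
    and idt_comp: "f \<in> Hom C X Y \<Longrightarrow> Comp C (Idt C Y) f = f"
    and comp_assoc: "f \<in> Hom C W X \<Longrightarrow> g \<in> Hom C X Y \<Longrightarrow> h \<in> Hom C Y Z \<Longrightarrow>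
          Comp C h (Comp C g f) = Comp C (Comp C h g) f"

definition Aut_group :: "('o, 'm) category_data \<Rightarrow> 'o \<Rightarrow> 'm monoid" where
  "Aut_group C X =
    \<lparr>carrier = {f \<in> Hom C X X. \<exists>g \<in> Hom C X X. Comp C g f = Idt C X \<and> Comp C f g = Idt C X},
     mult = Comp C,
     one = Idt C X\<rparr>"

lemma (in category) comp_inverses:
  assumes "f \<in> Hom C X X" "f' \<in> Hom C X X" "g \<in> Hom C X X" "g' \<in> Hom C X X"
    and "Comp C f' f = Idt C X" "Comp C g' g = Idt C X"
  shows "Comp C (Comp C g' f') (Comp C f g) = Idt C X"
proof -
  have "Comp C (Comp C g' f') (Comp C f g) = Comp C g' (Comp C f' (Comp C f g))"
    using comp_assoc[OF comp_in[OF assms(3,1)] assms(2,4)] by simp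
  also have "Comp C f' (Comp C f g) = Comp C (Comp C f' f) g"
    using comp_assoc[OF assms(3,1,2)] .
  finally show ?thesis
    using assms(5,6) idt_comp[OF assms(3)] by simp
qed

lemma (in category) group_Aut_group:
  assumes "X \<in> Obj C"
  shows "group (Aut_group C X)"
proof (rule groupI)
  fix f g assume "f \<in> carrier (Aut_group C X)" "g \<in> carrier (Aut_group C X)"
  then obtain f' g' where f: "f \<in> Hom C X X" "f' \<in> Hom C X X"
      "Comp C f' f = Idt C X" "Comp C f f' = Idt C X"
    and g: "g \<in> Hom C X X" "g' \<in> Hom C X X"
      "Comp C g' g = Idt C X" "Comp C g g' = Idt C X"
    by (auto simp: Aut_group_def)
  have "Comp C (Comp C g' f') (Comp C f g) = Idt C X"
    using comp_inverses[OF f(1,2) g(1,2) f(3) g(3)] .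
  moreover have "Comp C (Comp C f g) (Comp C g' f') = Idt C X"
    using comp_inverses[OF g(2,1) f(2,1) g(4) f(4)] .
  moreover have "Comp C f g \<in> Hom C X X" "Comp C g' f' \<in> Hom C X X"
    using comp_in f g by blast+
  ultimately show "f \<otimes>\<^bsub>Aut_group C X\<^esub> g \<in> carrier (Aut_group C X)"
    by (auto simp: Aut_group_def)
next
  show "\<one>\<^bsub>Aut_group C X\<^esub> \<in> carrier (Aut_group C X)"
    using idt_in[OF assms] idt_comp[OF idt_in[OF assms]] by (auto simp: Aut_group_def)
next
  fix f g h assume "f \<in> carrier (Aut_group C X)" "g \<in> carrier (Aut_group C X)"
    "h \<in> carrier (Aut_group C X)"
  then have "h \<in> Hom C X X" "g \<in> Hom C X X" "f \<in> Hom C X X"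
    by (auto simp: Aut_group_def)
  from comp_assoc[OF this]
  show "f \<otimes>\<^bsub>Aut_group C X\<^esub> g \<otimes>\<^bsub>Aut_group C X\<^esub> h =
      f \<otimes>\<^bsub>Aut_group C X\<^esub> (g \<otimes>\<^bsub>Aut_group C X\<^esub> h)"
    by (simp add: Aut_group_def)
next
  fix f assume "f \<in> carrier (Aut_group C X)"
  then show "\<one>\<^bsub>Aut_group C X\<^esub> \<otimes>\<^bsub>Aut_group C X\<^esub> f = f"
    using idt_comp[of f X X] by (simp add: Aut_group_def)
next
  fix f assume "f \<in> carrier (Aut_group C X)"
  then show "\<exists>g \<in> carrier (Aut_group C X). g \<otimes>\<^bsub>Aut_group C X\<^esub> f = \<one>\<^bsub>Aut_group C X\<^esub>"
    unfolding Aut_group_def by simp blast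
qed

section \<open>Presentations\<close>

text \<open>A word \<open>\<xi>\<^bsub>j(m)\<^esub> \<cdots> \<xi>\<^bsub>j(2)\<^esub> \<xi>\<^bsub>j(1)\<^esub>\<close> is encoded by the list \<open>[j(1), j(2), \<dots>, j(m)]\<close>,
  so the head of a list is the rightmost letter of the word. The same convention is used
  for words in the generators and their formal inverses, where \<open>(i, True)\<close> stands for
  \<open>\<xi>\<^sub>i\<close> and \<open>(i, False)\<close> for its inverse.\<close>

fun word_val :: "('g, 'b) monoid_scheme \<Rightarrow> (nat \<Rightarrow> 'g) \<Rightarrow> (nat \<times> bool) list \<Rightarrow> 'g" where
  "word_val G \<xi> [] = \<one>\<^bsub>G\<^esub>"
| "word_val G \<xi> ((i, e) # w) = word_val G \<xi> w \<otimes>\<^bsub>G\<^esub> (if e then \<xi> i else inv\<^bsub>G\<^esub> \<xi> i)"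

text \<open>The equivalence closure of \<open>pres_step n R\<close> is the congruence on words whose quotient
  is the group with generators \<open>1, \<dots>, n\<close> and relators \<open>R\<close>.\<close>

inductive pres_step :: "nat \<Rightarrow> nat list set \<Rightarrow> (nat \<times> bool) list \<Rightarrow> (nat \<times> bool) list \<Rightarrow> bool"
  for n R where
  cancel: "i \<in> {1..n} \<Longrightarrow> pres_step n R (u @ [(i, e), (i, \<not> e)] @ v) (u @ v)"
| relator: "p \<in> R \<Longrightarrow> pres_step n R (u @ map (\<lambda>i. (i, True)) p @ v) (u @ v)"

locale group_presentation = group G
  for G :: "('g, 'b) monoid_scheme" (structure) +
  fixes n :: nat and \<xi> :: "nat \<Rightarrow> 'g" and R :: "nat list set"
  assumes gens_closed: "\<xi> \<in> {1..n} \<rightarrow> carrier G"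
    and rels_wf: "p \<in> R \<Longrightarrow> p \<noteq> [] \<and> set p \<subseteq> {1..n}"
    and generated: "generate G (\<xi> ` {1..n}) = carrier G"
    and presented: "w \<in> lists ({1..n} \<times> UNIV) \<Longrightarrow>
          word_val G \<xi> w = \<one> \<longleftrightarrow> equivclp (pres_step n R) w []"

section \<open>Difference equations and cotranslations\<close>

text \<open>For \<open>p = [j(1), \<dots>, j(m)]\<close>, \<open>propagate G \<xi> M A p \<eta>\<close> is
  \<open>A\<^bsub>j(m)\<^esub>(\<xi>\<^bsub>j(m-1)\<^esub> \<cdots> \<xi>\<^bsub>j(1)\<^esub> \<eta>) \<circ> \<cdots> \<circ> A\<^bsub>j(2)\<^esub>(\<xi>\<^bsub>j(1)\<^esub> \<eta>) \<circ> A\<^bsub>j(1)\<^esub>(\<eta>)\<close>.\<close>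

fun propagate :: "('g, 'b) monoid_scheme \<Rightarrow> (nat \<Rightarrow> 'g) \<Rightarrow> 'm monoid \<Rightarrow>
    (nat \<Rightarrow> 'g \<Rightarrow> 'm) \<Rightarrow> nat list \<Rightarrow> 'g \<Rightarrow> 'm" where
  "propagate G \<xi> M A [] \<eta> = \<one>\<^bsub>M\<^esub>"
| "propagate G \<xi> M A (j # p) \<eta> = propagate G \<xi> M A p (\<xi> j \<otimes>\<^bsub>G\<^esub> \<eta>) \<otimes>\<^bsub>M\<^esub> A j \<eta>"

definition preserves_relations :: "('g, 'b) monoid_scheme \<Rightarrow> (nat \<Rightarrow> 'g) \<Rightarrow> nat list set \<Rightarrow>
    'm monoid \<Rightarrow> (nat \<Rightarrow> 'g \<Rightarrow> 'm) \<Rightarrow> bool" where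
  "preserves_relations G \<xi> R M A \<longleftrightarrow>
    (\<forall>p \<in> R. \<forall>\<eta> \<in> carrier G. \<one>\<^bsub>M\<^esub> = propagate G \<xi> M A p \<eta>)"

text \<open>The equation \<open>x(\<xi>\<^sub>i \<eta>) = A\<^sub>i(\<eta>) x(\<eta>)\<close> is identified with its family of coefficients
  \<open>A\<close>. Families and cotranslations are extensional functions, so that equality of the
  HOL functions is equality on \<open>{1..n}\<close> and the carrier of \<open>G\<close>.\<close>

definition difference_equations :: "('g, 'b) monoid_scheme \<Rightarrow> nat \<Rightarrow> (nat \<Rightarrow> 'g) \<Rightarrow>
    nat list set \<Rightarrow> 'm monoid \<Rightarrow> (nat \<Rightarrow> 'g \<Rightarrow> 'm) set" where
  "difference_equations G n \<xi> R M =
    {A \<in> {1..n} \<rightarrow>\<^sub>E (carrier G \<rightarrow>\<^sub>E carrier M). preserves_relations G \<xi> R M A}"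

definition cotranslations :: "('g, 'b) monoid_scheme \<Rightarrow> 'm monoid \<Rightarrow> ('g \<times> 'g \<Rightarrow> 'm) set" where
  "cotranslations G M =
    {Z \<in> carrier G \<times> carrier G \<rightarrow>\<^sub>E carrier M.
      \<forall>g \<in> carrier G. \<forall>h \<in> carrier G. \<forall>k \<in> carrier G.
        Z (g, k \<otimes>\<^bsub>G\<^esub> h) = Z (h \<otimes>\<^bsub>G\<^esub> g, k) \<otimes>\<^bsub>M\<^esub> Z (g, h)}"

end

theory Submission imports Defs begin

text \<open>A cotranslation \<open>Z\<close> is determined by the values \<open>Z (\<eta>, \<xi>\<^sub>i)\<close>, because the cocycle identity
  computes \<open>Z (g, h)\<close> along any word in the generators and their inverses that represents \<open>h\<close>;
  the inverse letters are governed by \<open>Z (\<eta>, \<xi>\<^sub>i\<^sup>-\<^sup>1) = Z (\<xi>\<^sub>i\<^sup>-\<^sup>1 \<eta>, \<xi>\<^sub>i)\<^sup>-\<^sup>1\<close>. Conversely, coefficients \<open>A\<close>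
  can be propagated along every such word. Cancellations and relators contribute the identity, so
  propagating along a word for the unit gives the identity, and therefore the result depends only on
  the group element that the word represents.\<close>

text \<open>An inverse letter crosses the edge from \<open>inv \<xi> i \<otimes> \<eta>\<close> to
  \<open>\<eta>\<close> backwards, so it contributes the inverse of the coefficient at the source of
  that edge.\<close>

fun propagate_word :: "('g, 'b) monoid_scheme \<Rightarrow> (nat \<Rightarrow> 'g) \<Rightarrow> ('m, 'c) monoid_scheme \<Rightarrow>
    (nat \<Rightarrow> 'g \<Rightarrow> 'm) \<Rightarrow> (nat \<times> bool) list \<Rightarrow> 'g \<Rightarrow> 'm" where
  "propagate_word G \<xi> M A [] \<eta> = \<one>\<^bsub>M\<^esub>"
| "propagate_word G \<xi> M A ((i, e) # w) \<eta> =
    propagate_word G \<xi> M A w ((if e then \<xi> i else inv\<^bsub>G\<^esub> \<xi> i) \<otimes>\<^bsub>G\<^esub> \<eta>) \<otimes>\<^bsub>M\<^esub>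
      (if e then A i \<eta> else inv\<^bsub>M\<^esub> A i (inv\<^bsub>G\<^esub> \<xi> i \<otimes>\<^bsub>G\<^esub> \<eta>))"

lemma propagate_word_positive:
  "propagate_word G \<xi> M A (map (\<lambda>i. (i, True)) p) \<eta> = propagate G \<xi> M A p \<eta>"
  by (induction p arbitrary: \<eta>) auto

context group_presentation
begin

declare One_nat_def [simp del]

section \<open>Words and the group elements they represent\<close>

abbreviation words :: "(nat \<times> bool) list set" where
  "words \<equiv> lists ({1..n} \<times> UNIV)"

lemma gen_closed [simp]: "i \<in> {1..n} \<Longrightarrow> \<xi> i \<in> carrier G"
  using gens_closed by blast

lemma word_val_closed [simp]: "w \<in> words \<Longrightarrow> word_val G \<xi> w \<in> carrier G"
  by (induction w) auto

text \<open>The order flips because the head of a list is the rightmost letter.\<close>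

lemma word_val_append:
  "u \<in> words \<Longrightarrow> v \<in> words \<Longrightarrow> word_val G \<xi> (u @ v) = word_val G \<xi> v \<otimes> word_val G \<xi> u"
proof (induction u)
  case (Cons x u)
  obtain i e where "x = (i, e)" by fastforce
  with Cons show ?case by (cases e) (simp_all add: m_assoc)
qed simp

lemma word_exists:
  assumes "g \<in> carrier G"
  obtains w where "w \<in> words" "word_val G \<xi> w = g"
proof -
  have "g \<in> generate G (\<xi> ` {1..n})"
    using assms generated by simp
  then have "\<exists>w\<in>words. word_val G \<xi> w = g"
  proof induction
    case one
    show ?case by (rule bexI[of _ "[]"]) auto
  next
    case (incl h)
    then obtain i where "i \<in> {1..n}" "h = \<xi> i" by blast
    then show ?case by (intro bexI[of _ "[(i, True)]"]) auto
  next
    case (inv h)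
    then obtain i where "i \<in> {1..n}" "h = \<xi> i" by blast
    then show ?case by (intro bexI[of _ "[(i, False)]"]) auto
  next
    case (eng h k)
    then obtain u v where "u \<in> words" "v \<in> words" "word_val G \<xi> u = h" "word_val G \<xi> v = k"
      by blast
    then show ?case
      by (intro bexI[of _ "v @ u"]) (auto simp: word_val_append)
  qed
  then show thesis using that by blast
qed

lemma relator_in_words: "p \<in> R \<Longrightarrow> map (\<lambda>i. (i, True)) p \<in> words"
  using rels_wf by fastforce

text \<open>Deleting \<open>p\<close> with empty context on both sides is a single elementary step
  to the empty word.\<close>

lemma word_val_relator:
  assumes "p \<in> R"
  shows "word_val G \<xi> (map (\<lambda>i. (i, True)) p) = \<one>"
proof -
  have "pres_step n R (map (\<lambda>i. (i, True)) p) []"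
    using pres_step.relator[OF assms, of n "[]" "[]"] by simp
  then show ?thesis
    using presented[OF relator_in_words[OF assms]] by blast
qed

text \<open>The contexts in \<open>pres_step\<close> are arbitrary lists, and an equivalence chain
  runs through steps in both directions. This keeps every intermediate list of such a chain inside
  \<open>words\<close>.\<close>

lemma pres_step_words: "pres_step n R w w' \<Longrightarrow> w \<in> words \<longleftrightarrow> w' \<in> words"
  by (induction rule: pres_step.induct) (use relator_in_words in auto)

section \<open>Propagation of coefficients along words\<close>

lemma propagate_word_closed [simp]:
  assumes "group M" "A \<in> {1..n} \<rightarrow> carrier G \<rightarrow> carrier M"
  shows "w \<in> words \<Longrightarrow> \<eta> \<in> carrier G \<Longrightarrow> propagate_word G \<xi> M A w \<eta> \<in> carrier M"
proof (induction w arbitrary: \<eta>)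
  case Nil
  show ?case using assms(1) by (simp add: group.is_monoid)
next
  case (Cons x w)
  interpret M: group M by fact
  have "A i \<theta> \<in> carrier M" if "i \<in> {1..n}" "\<theta> \<in> carrier G" for i \<theta>
    using assms(2) that by blast
  with Cons show ?case by (cases x) auto
qed

text \<open>Traversing \<open>u\<close> from \<open>\<eta>\<close> ends at
  \<open>word_val G \<xi> u \<otimes> \<eta>\<close>, which is where \<open>v\<close> takes
  over.\<close>

lemma propagate_word_append:
  assumes "group M" "A \<in> {1..n} \<rightarrow> carrier G \<rightarrow> carrier M"
  shows "u \<in> words \<Longrightarrow> v \<in> words \<Longrightarrow> \<eta> \<in> carrier G \<Longrightarrow>
    propagate_word G \<xi> M A (u @ v) \<eta> =
      propagate_word G \<xi> M A v (word_val G \<xi> u \<otimes> \<eta>) \<otimes>\<^bsub>M\<^esub> propagate_word G \<xi> M A u \<eta>"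
proof (induction u arbitrary: \<eta>)
  case Nil
  interpret M: group M by fact
  show ?case using Nil assms by simp
next
  case (Cons x u)
  interpret M: group M by fact
  obtain i e where x: "x = (i, e)" by fastforce
  have "A j \<theta> \<in> carrier M" if "j \<in> {1..n}" "\<theta> \<in> carrier G" for j \<theta>
    using assms(2) that by blast
  with Cons assms show ?case
    by (cases e) (auto simp: x m_assoc M.m_assoc)
qed

lemma propagate_word_pres_step:
  assumes M: "group M" and A: "A \<in> {1..n} \<rightarrow> carrier G \<rightarrow> carrier M"
    and pres: "preserves_relations G \<xi> R M A"
    and "pres_step n R w w'" "w \<in> words" "\<eta> \<in> carrier G"
  shows "propagate_word G \<xi> M A w \<eta> = propagate_word G \<xi> M A w' \<eta>"
proof -
  interpret M: group M by fact
  \<comment> \<open>A trivial value of \<open>t\<close> leaves the starting point of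
    \<open>v\<close> unchanged, and trivial propagation along \<open>t\<close> leaves the product
    unchanged.\<close>
  have insert_trivial: "propagate_word G \<xi> M A (u @ t @ v) \<eta> = propagate_word G \<xi> M A (u @ v) \<eta>"
    if "u \<in> words" "t \<in> words" "v \<in> words" "word_val G \<xi> t = \<one>"
      "\<And>\<theta>. \<theta> \<in> carrier G \<Longrightarrow> propagate_word G \<xi> M A t \<theta> = \<one>\<^bsub>M\<^esub>" for u t v
    using that \<open>\<eta> \<in> carrier G\<close> by (simp add: propagate_word_append[OF M A] M A)
  show ?thesis
    using assms(4)
  proof cases
    case (cancel i u e v)
    have Ai: "A i \<theta> \<in> carrier M" if "\<theta> \<in> carrier G" for \<theta>
      using A cancel that by blast
    have "word_val G \<xi> [(i, e), (i, \<not> e)] = \<one>"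
      using cancel by (cases e) auto
    \<comment> \<open>For either order of the two letters, both evaluate \<open>A i\<close> at the
      same point: \<open>\<theta>\<close> if \<open>e\<close> holds,
      \<open>inv \<xi> i \<otimes> \<theta>\<close> otherwise. The factors are therefore mutually
      inverse.\<close>
    moreover have "propagate_word G \<xi> M A [(i, e), (i, \<not> e)] \<theta> = \<one>\<^bsub>M\<^esub>" if "\<theta> \<in> carrier G" for \<theta>
      using cancel that Ai by (cases e) (auto simp: m_assoc[symmetric])
    ultimately show ?thesis
      unfolding cancel using cancel assms(5) by (intro insert_trivial) auto
  next
    case (relator p u v)
    have "propagate_word G \<xi> M A (map (\<lambda>i. (i, True)) p) \<theta> = \<one>\<^bsub>M\<^esub>" if "\<theta> \<in> carrier G" for \<theta>
      using pres relator that by (simp add: propagate_word_positive preserves_relations_def)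
    then show ?thesis
      unfolding relator using relator assms(5)
      by (intro insert_trivial word_val_relator relator_in_words) auto
  qed
qed

lemma propagate_word_eq_one:
  assumes M: "group M" and A: "A \<in> {1..n} \<rightarrow> carrier G \<rightarrow> carrier M"
    and pres: "preserves_relations G \<xi> R M A"
    and "w \<in> words" "word_val G \<xi> w = \<one>" "\<eta> \<in> carrier G"
  shows "propagate_word G \<xi> M A w \<eta> = \<one>\<^bsub>M\<^esub>"
proof -
  have "equivclp (pres_step n R) w []"
    using presented assms(4,5) by blast
  \<comment> \<open>Membership in \<open>words\<close> is carried along the chain because invariance
    under a step requires it.\<close>
  then have "[] \<in> words \<and> propagate_word G \<xi> M A [] \<eta> = propagate_word G \<xi> M A w \<eta>"
  proof (induction rule: equivclp_induct)
    case base
    show ?case using assms(4) by simp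
  next
    case (step v v')
    then show ?case
      using pres_step_words propagate_word_pres_step[OF M A pres _ _ \<open>\<eta> \<in> carrier G\<close>] by metis
  qed
  then show ?thesis by simp
qed

text \<open>Appending one word \<open>w\<close> for the inverse turns both \<open>u\<close> and
  \<open>v\<close> into words for the unit. Propagation along \<open>w\<close> from the common
  endpoint is then a left inverse of both results, and cancels.\<close>

lemma propagate_word_cong:
  assumes M: "group M" and A: "A \<in> {1..n} \<rightarrow> carrier G \<rightarrow> carrier M"
    and pres: "preserves_relations G \<xi> R M A"
    and u: "u \<in> words" and v: "v \<in> words" and eq: "word_val G \<xi> u = word_val G \<xi> v"
    and \<eta>: "\<eta> \<in> carrier G"
  shows "propagate_word G \<xi> M A u \<eta> = propagate_word G \<xi> M A v \<eta>"
proof -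
  interpret M: group M by fact
  obtain w where w: "w \<in> words" "word_val G \<xi> w = inv (word_val G \<xi> v)"
    using word_exists v by (metis inv_closed word_val_closed)
  have "propagate_word G \<xi> M A w (word_val G \<xi> v \<otimes> \<eta>) \<otimes>\<^bsub>M\<^esub> propagate_word G \<xi> M A t \<eta> = \<one>\<^bsub>M\<^esub>"
    if "t \<in> words" "word_val G \<xi> t = word_val G \<xi> v" for t
    using propagate_word_eq_one[OF M A pres, of "t @ w" \<eta>] propagate_word_append[OF M A, of t w \<eta>]
      that w v \<eta> by (simp add: word_val_append)
  from this[OF u eq] this[OF v refl] show ?thesis
    using u v w \<eta> by (metis M A M.Units_l_cancel M.Units_eq m_closed propagate_word_closed word_val_closed)
qed

section \<open>Cotranslations along words and the bijection\<close>

text \<open>Both sides satisfy the same recursion: in the cocycle identity, take \<open>h\<close> to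
  be the head letter and \<open>k\<close> the value of the remaining word. This serves both
  injectivity and preservation of relations.\<close>

lemma cotranslation_word:
  assumes M: "group M" and Z: "Z \<in> cotranslations G M"
  shows "w \<in> words \<Longrightarrow> \<eta> \<in> carrier G \<Longrightarrow>
    propagate_word G \<xi> M (\<lambda>i \<in> {1..n}. \<lambda>\<eta> \<in> carrier G. Z (\<eta>, \<xi> i)) w \<eta> = Z (\<eta>, word_val G \<xi> w)"
proof (induction w arbitrary: \<eta>)
  interpret M: group M by fact
  have closed: "Z (g, h) \<in> carrier M" if "g \<in> carrier G" "h \<in> carrier G" for g h
    using Z that by (auto simp: cotranslations_def)
  have cocycle: "Z (g, k \<otimes> h) = Z (h \<otimes> g, k) \<otimes>\<^bsub>M\<^esub> Z (g, h)"
    if "g \<in> carrier G" "h \<in> carrier G" "k \<in> carrier G" for g h k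
    using Z that by (auto simp: cotranslations_def)
  \<comment> \<open>With \<open>h\<close> and \<open>k\<close> equal to the unit, the cocycle
    identity makes \<open>Z (g, \<one>)\<close> idempotent in a group.\<close>
  have unit: "Z (g, \<one>) = \<one>\<^bsub>M\<^esub>" if "g \<in> carrier G" for g
    using cocycle[of g \<one> \<one>] closed[of g \<one>] that by simp
  {
    case Nil
    then show ?case by (simp add: unit)
  next
    case (Cons x w)
    obtain i e where x: "x = (i, e)" by fastforce
    have i: "i \<in> {1..n}" and w: "w \<in> words"
      using Cons.prems x by auto
    have left_inv: "Z (inv \<xi> i \<otimes> \<eta>, \<xi> i) \<otimes>\<^bsub>M\<^esub> Z (\<eta>, inv \<xi> i) = \<one>\<^bsub>M\<^esub>"
      using cocycle[of \<eta> "inv \<xi> i" "\<xi> i"] i Cons.prems(2) by (simp add: unit)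
    have "inv\<^bsub>M\<^esub> Z (inv \<xi> i \<otimes> \<eta>, \<xi> i) = Z (\<eta>, inv \<xi> i)"
      using M.inv_equality[OF M.inv_comm[OF left_inv]] i Cons.prems(2) by (simp add: closed)
    then show ?case
      using Cons.IH[OF w] Cons.prems(2) i w x by (auto simp: cocycle)
  }
qed

lemma bij_betw_cotranslations_difference_equations:
  fixes M :: "'m monoid"
  assumes M: "group M"
  shows "bij_betw (\<lambda>Z. \<lambda>i \<in> {1..n}. \<lambda>\<eta> \<in> carrier G. Z (\<eta>, \<xi> i))
    (cotranslations G M) (difference_equations G n \<xi> R M)"
    (is "bij_betw ?\<Phi> _ _")
proof (rule bij_betw_imageI)
  interpret M: group M by fact
  show "inj_on ?\<Phi> (cotranslations G M)"
  proof (rule inj_onI)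
    fix Z Z' assume Z: "Z \<in> cotranslations G M" "Z' \<in> cotranslations G M" and eq: "?\<Phi> Z = ?\<Phi> Z'"
    have "Z (g, h) = Z' (g, h)" if "g \<in> carrier G" "h \<in> carrier G" for g h
    proof -
      obtain w where "w \<in> words" "word_val G \<xi> w = h"
        using word_exists[OF \<open>h \<in> carrier G\<close>] .
      then show ?thesis
        using Z[THEN cotranslation_word[OF M], of w g] that eq by simp
    qed
    then show "Z = Z'"
      using Z by (intro PiE_ext[of Z "carrier G \<times> carrier G" "\<lambda>_. carrier M"])
        (auto simp: cotranslations_def)
  qed
  show "?\<Phi> ` cotranslations G M = difference_equations G n \<xi> R M"
  proof (intro equalityI subsetI)
    fix A assume "A \<in> ?\<Phi> ` cotranslations G M"
    then obtain Z where Z: "Z \<in> cotranslations G M" and A: "A = ?\<Phi> Z" by blast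
    have "propagate G \<xi> M A p \<eta> = \<one>\<^bsub>M\<^esub>" if "p \<in> R" "\<eta> \<in> carrier G" for p \<eta>
    proof -
      \<comment> \<open>A relator is a positive word representing the unit.\<close>
      have "propagate G \<xi> M A p \<eta> = Z (\<eta>, \<one>)"
        using cotranslation_word[OF M Z relator_in_words that(2)] that
        by (simp add: A propagate_word_positive word_val_relator)
      also have "\<dots> = \<one>\<^bsub>M\<^esub>"
        using cotranslation_word[OF M Z, of "[]" \<eta>] that by simp
      finally show ?thesis .
    qed
    moreover have "A \<in> {1..n} \<rightarrow>\<^sub>E carrier G \<rightarrow>\<^sub>E carrier M"
      using Z by (auto simp: A cotranslations_def)
    ultimately show "A \<in> difference_equations G n \<xi> R M"
      by (simp add: difference_equations_def preserves_relations_def)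
  next
    fix A assume "A \<in> difference_equations G n \<xi> R M"
    then have A_ext: "A \<in> {1..n} \<rightarrow>\<^sub>E carrier G \<rightarrow>\<^sub>E carrier M"
      and pres: "preserves_relations G \<xi> R M A"
      by (auto simp: difference_equations_def)
    then have A: "A \<in> {1..n} \<rightarrow> carrier G \<rightarrow> carrier M"
      by fastforce
    \<comment> \<open>The choice of a word for each \<open>h\<close> is harmless by
      \<open>propagate_word_cong\<close>; \<open>Z_word\<close> below frees \<open>Z\<close> from
      it.\<close>
    define wd where "wd h = (SOME w. w \<in> words \<and> word_val G \<xi> w = h)" for h
    have wd: "wd h \<in> words" "word_val G \<xi> (wd h) = h" if "h \<in> carrier G" for h
      using someI_ex[of "\<lambda>w. w \<in> words \<and> word_val G \<xi> w = h"] word_exists[OF that]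
      unfolding wd_def by blast+
    define Z where "Z = (\<lambda>(g, h) \<in> carrier G \<times> carrier G. propagate_word G \<xi> M A (wd h) g)"
    have Z_word: "Z (g, word_val G \<xi> w) = propagate_word G \<xi> M A w g"
      if "g \<in> carrier G" "w \<in> words" for g w
      using propagate_word_cong[OF M A pres, of "wd (word_val G \<xi> w)" w g] that wd
      by (simp add: Z_def)
    \<comment> \<open>The word \<open>wd h @ wd k\<close> represents \<open>k \<otimes> h\<close>
      but may differ from \<open>wd (k \<otimes> h)\<close>; \<open>Z_word\<close> permits its use,
      and splitting it yields the cocycle identity.\<close>
    have "Z (g, k \<otimes> h) = Z (h \<otimes> g, k) \<otimes>\<^bsub>M\<^esub> Z (g, h)"
      if "g \<in> carrier G" "h \<in> carrier G" "k \<in> carrier G" for g h k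
      using that wd Z_word[of g "wd h @ wd k"] Z_word[of g "wd h"] Z_word[of "h \<otimes> g" "wd k"]
      by (simp add: word_val_append propagate_word_append[OF M A])
    moreover have "Z \<in> carrier G \<times> carrier G \<rightarrow>\<^sub>E carrier M"
      using wd by (auto simp: Z_def M A)
    ultimately have "Z \<in> cotranslations G M"
      by (simp add: cotranslations_def)
    moreover have "?\<Phi> Z = A"
    proof (intro ext)
      fix i \<eta>
      \<comment> \<open>Off the index set and off the carrier, both families take the default value
        of extensional functions.\<close>
      have "A i = undefined" if "i \<notin> {1..n}"
        using A_ext that by (auto simp: PiE_def extensional_def)
      moreover have "A i \<eta> = undefined" if "i \<in> {1..n}" "\<eta> \<notin> carrier G"
        using A_ext that by (meson PiE_arb PiE_mem)
      moreover have "Z (\<eta>, \<xi> i) = A i \<eta>" if "i \<in> {1..n}" "\<eta> \<in> carrier G"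
      proof -
        have "A i \<eta> \<in> carrier M"
          using A that by blast
        then show ?thesis
          using Z_word[of \<eta> "[(i, True)]"] that by simp
      qed
      ultimately show "?\<Phi> Z i \<eta> = A i \<eta>"
        by (auto simp: restrict_def)
    qed
    ultimately show "A \<in> ?\<Phi> ` cotranslations G M"
      by blast
  qed
qed

end

theorem proposition3p15:
  fixes G :: "('g, 'b) monoid_scheme"
    and n :: nat and \<xi> :: "nat \<Rightarrow> 'g" and R :: "nat list set"
    and C :: "('o, 'm) category_data" and X :: 'o
  assumes "group_presentation G n \<xi> R"
    and "category C" and "X \<in> Obj C"
  shows "bij_betw
    (\<lambda>Z. \<lambda>i \<in> {1..n}. \<lambda>\<eta> \<in> carrier G. Z (\<eta>, \<xi> i))
    (cotranslations G (Aut_group C X))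
    (difference_equations G n \<xi> R (Aut_group C X))"
  \<comment> \<open>The automorphisms of \<open>X\<close> form a group under composition, which
    serves as the coefficient group \<open>M\<close>.\<close>
  using group_presentation.bij_betw_cotranslations_difference_equations[OF assms(1)]
    category.group_Aut_group[OF assms(2,3)] .

end
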